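(* Let $(\mathrm{P}(\xi),\ \xi\in\mathcal{U})$ be an uncertain optimization problem with uncertainty set $\mathcal{U}=\mathrm{conv}(\mathcal{U}')$, where $\mathcal{U}':=\{\xi^1,\ldots,\xi^N\}$. Let $F(x,\xi)=G(x)-b(\xi)$ with a (componentwise) convex function $G:\mathbb{R}^n\to\mathbb{R}^m$ and a (componentwise) concave function $b:\mathbb{R}^M\to\mathbb{R}^m$. Let $f(x,\xi)$ be jointly quasiconvex in $(x,\xi)$, let $\mathcal{X}$ be convex, and let $d(x,\cdot)$ be quasiconvex (for every $x$). Then $\mathrm{Rec}(\mathcal{U})$ and $\mathrm{Rec}(\mathcal{U}')$ have the same recoverable-robust solutions.
   Context: $\mathcal{X}\subseteq\mathbb{R}^n$ is closed, $\mathcal{U}\subseteq\mathbb{R}^M$ has at least two elements, for each $\xi\in\mathcal{U}$ the functions $F(\cdot,\xi):\mathbb{R}^n\to\mathbb{R}^m$ and $f(\cdot,\xi):\mathbb{R}^n\to\mathbb{R}$ are continuous, and $d:\mathbb{R}^n\times\mathbb{R}^n\to\mathbb{R}$ is a metric. $\mathrm{P}(\xi)$ is: minimize $f(x,\xi)$ subject to $F(x,\xi)\le 0$ (componentwise), $x\in\mathcal{X}$. For a set of scenarios $\mathcal{V}\subseteq\mathcal{U}$, $\mathrm{Rec}(\mathcal{V})$ is the biobjective problem: minimize $(\mathbf{f}_{\mathcal{V}}(y),\mathbf{r}_{\mathcal{V}}(x,y))=\left(\sup_{\xi\in\mathcal{V}}f(y(\xi),\xi),\ \sup_{\xi\in\mathcal{V}}d(x,y(\xi))\right)$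 subject to $F(y(\xi),\xi)\le 0$ for all $\xi\in\mathcal{V}$, $x\in\mathcal{X}$, $y:\mathcal{V}\to\mathcal{X}$. A feasible $(x,y)$ is Pareto efficient for $\mathrm{Rec}(\mathcal{V})$ if there is no feasible $(x',y')$ with $\mathbf{f}_{\mathcal{V}}(y')\le\mathbf{f}_{\mathcal{V}}(y)$ and $\mathbf{r}_{\mathcal{V}}(x',y')\le\mathbf{r}_{\mathcal{V}}(x,y)$ where at least one of the inequalities is strict. A point $x\in\mathcal{X}$ is a recoverable-robust solution of $\mathrm{Rec}(\mathcal{V})$ if there exists $y:\mathcal{V}\to\mathcal{X}$ such that $(x,y)$ is Pareto efficient for $\mathrm{Rec}(\mathcal{V})$. *)

theory Defs
  imports "HOL-Analysis.Analysis"
begin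

definition quasiconvex_on :: "'a::real_vector set \<Rightarrow> ('a \<Rightarrow> real) \<Rightarrow> bool" where
  "quasiconvex_on S g \<longleftrightarrow> convex S \<and>
     (\<forall>x\<in>S. \<forall>y\<in>S. \<forall>u\<ge>0. \<forall>v\<ge>0. u + v = 1 \<longrightarrow> g (u *\<^sub>R x + v *\<^sub>R y) \<le> max (g x) (g y))"

text \<open>
  Instances \<open>P(\<xi>)\<close> (minimize \<open>f x \<xi>\<close> subject to \<open>F x \<xi> \<le> 0\<close> and \<open>x \<in> X\<close>) are given by the data
  \<open>X\<close>, \<open>F\<close>, \<open>f\<close>. Below, \<open>V\<close> is a set of scenarios and \<open>Rec(V)\<close> the biobjective recovery problem.
  The order on vectors is the componentwise one. The objectives take values in the extended reals,
  since the suprema over an infinite \<open>V\<close> need not be finite. A recovery strategy \<open>y : V \<rightarrow> X\<close> is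
  an extensional function, i.e. it carries no information outside \<open>V\<close>.
\<close>

definition rec_feasible ::
    "(real^'n) set \<Rightarrow> (real^'n \<Rightarrow> real^'k \<Rightarrow> real^'m) \<Rightarrow> (real^'k) set
      \<Rightarrow> real^'n \<Rightarrow> (real^'k \<Rightarrow> real^'n) \<Rightarrow> bool" where
  "rec_feasible X F V x y \<longleftrightarrow> (\<forall>\<xi>\<in>V. F (y \<xi>) \<xi> \<le> 0) \<and> x \<in> X \<and> y \<in> V \<rightarrow>\<^sub>E X"

definition rec_cost ::
    "(real^'n \<Rightarrow> real^'k \<Rightarrow> real) \<Rightarrow> (real^'k) set \<Rightarrow> (real^'k \<Rightarrow> real^'n) \<Rightarrow> ereal" where
  "rec_cost f V y = (SUP \<xi>\<in>V. ereal (f (y \<xi>) \<xi>))"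

definition rec_distance ::
    "(real^'n \<Rightarrow> real^'n \<Rightarrow> real) \<Rightarrow> (real^'k) set \<Rightarrow> real^'n \<Rightarrow> (real^'k \<Rightarrow> real^'n) \<Rightarrow> ereal" where
  "rec_distance d V x y = (SUP \<xi>\<in>V. ereal (d x (y \<xi>)))"

definition rec_pareto_efficient ::
    "(real^'n) set \<Rightarrow> (real^'n \<Rightarrow> real^'k \<Rightarrow> real^'m) \<Rightarrow> (real^'n \<Rightarrow> real^'k \<Rightarrow> real)
      \<Rightarrow> (real^'n \<Rightarrow> real^'n \<Rightarrow> real) \<Rightarrow> (real^'k) set
      \<Rightarrow> real^'n \<Rightarrow> (real^'k \<Rightarrow> real^'n) \<Rightarrow> bool" where
  "rec_pareto_efficient X F f d V x y \<longleftrightarrow>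
     rec_feasible X F V x y \<and>
     \<not> (\<exists>x' y'. rec_feasible X F V x' y' \<and>
          rec_cost f V y' \<le> rec_cost f V y \<and> rec_distance d V x' y' \<le> rec_distance d V x y \<and>
          (rec_cost f V y' < rec_cost f V y \<or> rec_distance d V x' y' < rec_distance d V x y))"

definition recoverable_robust_solutions ::
    "(real^'n) set \<Rightarrow> (real^'n \<Rightarrow> real^'k \<Rightarrow> real^'m) \<Rightarrow> (real^'n \<Rightarrow> real^'k \<Rightarrow> real)
      \<Rightarrow> (real^'n \<Rightarrow> real^'n \<Rightarrow> real) \<Rightarrow> (real^'k) set \<Rightarrow> (real^'n) set" where
  "recoverable_robust_solutions X F f d V =
     {x \<in> X. \<exists>y \<in> V \<rightarrow>\<^sub>E X. rec_pareto_efficient X F f d V x y}"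

end

(* The pairs (z, \<xi>) such that z is feasible for scenario \<xi>, costs at most c there and lies within
   distance r of x form a convex set. So does its projection onto the scenarios; hence if the
   projection covers U', it covers conv U', and a recovery strategy for U' extends to conv U'
   without increasing either objective. Conversely, restricting a strategy to fewer scenarios
   cannot increase an objective either, so efficient pairs transfer in both directions. *)
theory Submission imports Defs begin

lemma quasiconvex_onD:
  assumes "quasiconvex_on S g" "x \<in> S" "y \<in> S" "0 \<le> u" "0 \<le> v" "u + v = 1"
  shows "g (u *\<^sub>R x + v *\<^sub>R y) \<le> max (g x) (g y)"
  using assms unfolding quasiconvex_on_def by blast

lemma rec_feasible_restrict:
  assumes "rec_feasible X F U x y" "V \<subseteq> U"
  shows "rec_feasible X F V x (restrict y V)"
  using assms unfolding rec_feasible_def by (auto simp: PiE_def Pi_def)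

lemma rec_cost_restrict_le:
  assumes "V \<subseteq> U"
  shows "rec_cost f V (restrict y V) \<le> rec_cost f U y"
  unfolding rec_cost_def using assms by (intro SUP_subset_mono) auto

lemma rec_distance_restrict_le:
  assumes "V \<subseteq> U"
  shows "rec_distance d V x (restrict y V) \<le> rec_distance d U x y"
  unfolding rec_distance_def using assms by (intro SUP_subset_mono) auto

lemma recoverable_robust_solutions_iff:
  "x \<in> recoverable_robust_solutions X F f d V \<longleftrightarrow> (\<exists>y. rec_pareto_efficient X F f d V x y)"
  unfolding recoverable_robust_solutions_def rec_pareto_efficient_def rec_feasible_def by blast

text \<open>Restricting to \<open>V\<close> and the map supplied by \<open>extend\<close> both keep
  the point \<open>x\<close> and never increase either objective. A pair that dominates over one
  scenario set can therefore be carried to the other set, where it would dominate an efficient pair.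
  Convexity enters only later, when \<open>extend\<close> is established.\<close>

lemma recoverable_robust_solutions_eqI:
  assumes sub: "V \<subseteq> U"
    and extend: "\<And>x y. rec_feasible X F V x y \<Longrightarrow>
      \<exists>y'. rec_feasible X F U x y' \<and> rec_cost f U y' \<le> rec_cost f V y
        \<and> rec_distance d U x y' \<le> rec_distance d V x y"
  shows "recoverable_robust_solutions X F f d U = recoverable_robust_solutions X F f d V"
proof (intro set_eqI iffI)
  fix x assume "x \<in> recoverable_robust_solutions X F f d U"
  then obtain y where y: "rec_pareto_efficient X F f d U x y"
    by (auto simp: recoverable_robust_solutions_iff)
  have "rec_pareto_efficient X F f d V x (restrict y V)"
    unfolding rec_pareto_efficient_def
  proof (intro conjI notI)
    show "rec_feasible X F V x (restrict y V)"
      using y sub unfolding rec_pareto_efficient_def by (blast intro: rec_feasible_restrict)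
    assume "\<exists>x' y'. rec_feasible X F V x' y' \<and>
      rec_cost f V y' \<le> rec_cost f V (restrict y V) \<and>
      rec_distance d V x' y' \<le> rec_distance d V x (restrict y V) \<and>
      (rec_cost f V y' < rec_cost f V (restrict y V) \<or>
       rec_distance d V x' y' < rec_distance d V x (restrict y V))"
    then obtain x' y' where y': "rec_feasible X F V x' y'"
      "rec_cost f V y' \<le> rec_cost f V (restrict y V)"
      "rec_distance d V x' y' \<le> rec_distance d V x (restrict y V)"
      "rec_cost f V y' < rec_cost f V (restrict y V) \<or>
       rec_distance d V x' y' < rec_distance d V x (restrict y V)"
      by blast
    \<comment> \<open>The competitor over \<open>V\<close> is lifted to \<open>U\<close>, where it
      will contradict the efficiency of \<open>y\<close>.\<close>
    obtain z where z: "rec_feasible X F U x' z" "rec_cost f U z \<le> rec_cost f V y'"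
      "rec_distance d U x' z \<le> rec_distance d V x' y'"
      using extend[OF y'(1)] by blast
    \<comment> \<open>Each objective descends along \<open>y\<close> on \<open>U\<close>,
      \<open>restrict y V\<close>, \<open>y'\<close> on \<open>V\<close>, \<open>z\<close> on
      \<open>U\<close>. The outer links are weak, so a strict middle link makes the whole chain
      strict.\<close>
    have "rec_cost f U z \<le> rec_cost f U y" "rec_distance d U x' z \<le> rec_distance d U x y"
      "rec_cost f U z < rec_cost f U y \<or> rec_distance d U x' z < rec_distance d U x y"
      using z(2,3) y'(2-4) rec_cost_restrict_le[OF sub, of f y]
        rec_distance_restrict_le[OF sub, of d x y]
      by (meson order_trans le_less_trans less_le_trans)+
    with y z(1) show False unfolding rec_pareto_efficient_def by blast
  qed
  then show "x \<in> recoverable_robust_solutions X F f d V"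
    by (auto simp: recoverable_robust_solutions_iff)
next
  fix x assume "x \<in> recoverable_robust_solutions X F f d V"
  then obtain y where y: "rec_pareto_efficient X F f d V x y"
    by (auto simp: recoverable_robust_solutions_iff)
  then obtain z where z: "rec_feasible X F U x z" "rec_cost f U z \<le> rec_cost f V y"
    "rec_distance d U x z \<le> rec_distance d V x y"
    using extend unfolding rec_pareto_efficient_def by blast
  \<comment> \<open>Any extension \<open>z\<close> that is no worse than \<open>y\<close> is
    efficient: a competitor of \<open>z\<close> on \<open>U\<close>, once restricted to
    \<open>V\<close>, would compete with \<open>y\<close>.\<close>
  have "rec_pareto_efficient X F f d U x z"
    unfolding rec_pareto_efficient_def
  proof (intro conjI notI z(1))
    assume "\<exists>x' y'. rec_feasible X F U x' y' \<and>
      rec_cost f U y' \<le> rec_cost f U z \<and> rec_distance d U x' y' \<le> rec_distance d U x z \<and>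
      (rec_cost f U y' < rec_cost f U z \<or> rec_distance d U x' y' < rec_distance d U x z)"
    then obtain x' y' where y': "rec_feasible X F U x' y'"
      "rec_cost f U y' \<le> rec_cost f U z" "rec_distance d U x' y' \<le> rec_distance d U x z"
      "rec_cost f U y' < rec_cost f U z \<or> rec_distance d U x' y' < rec_distance d U x z"
      by blast
    \<comment> \<open>Here the chain is \<open>y\<close> on \<open>V\<close>, \<open>z\<close> on
      \<open>U\<close>, \<open>y'\<close> on \<open>U\<close>, \<open>restrict y' V\<close>, again
      with strictness in the middle.\<close>
    have "rec_cost f V (restrict y' V) \<le> rec_cost f V y"
      "rec_distance d V x' (restrict y' V) \<le> rec_distance d V x y"
      "rec_cost f V (restrict y' V) < rec_cost f V y \<or>
       rec_distance d V x' (restrict y' V) < rec_distance d V x y"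
      using z(2,3) y'(2-4) rec_cost_restrict_le[OF sub, of f y']
        rec_distance_restrict_le[OF sub, of d x' y']
      by (meson order_trans le_less_trans less_le_trans)+
    with y rec_feasible_restrict[OF y'(1) sub] show False
      unfolding rec_pareto_efficient_def by blast
  qed
  then show "x \<in> recoverable_robust_solutions X F f d U"
    by (auto simp: recoverable_robust_solutions_iff)
qed

text \<open>Convex \<open>G\<close> below concave \<open>b\<close> is a convex condition on the
  pair, and the two bounds are sublevel sets of quasiconvex functions. Both coordinates move at
  once, which is why \<open>f\<close> is taken jointly quasiconvex. \<open>h\<close> stands for the
  distance to a fixed \<open>x\<close>; \<open>c\<close> and \<open>r\<close> are extended reals so
  that they can be suprema.\<close>

lemma convex_recovery_region:
  fixes f :: "real^'n \<Rightarrow> real^'k \<Rightarrow> real" and h :: "real^'n \<Rightarrow> real"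
    and G :: "real^'n \<Rightarrow> real^'m" and b :: "real^'k \<Rightarrow> real^'m" and c r :: ereal
  assumes X: "convex X" and U: "convex U"
    and G: "\<And>i. convex_on UNIV (\<lambda>x. G x $ i)"
    and b: "\<And>i. concave_on UNIV (\<lambda>\<xi>. b \<xi> $ i)"
    and f: "quasiconvex_on (UNIV \<times> U) (\<lambda>(x, \<xi>). f x \<xi>)"
    and h: "quasiconvex_on UNIV h"
  shows "convex {(z, \<xi>). z \<in> X \<and> \<xi> \<in> U \<and> G z \<le> b \<xi> \<and> ereal (f z \<xi>) \<le> c \<and> ereal (h z) \<le> r}"
proof (rule convexI, clarsimp, intro conjI)
  fix z1 z2 :: "real^'n" and s t :: "real^'k" and u v :: real
  assume uv: "0 \<le> u" "0 \<le> v" "u + v = 1" and z: "z1 \<in> X" "z2 \<in> X" and st: "s \<in> U" "t \<in> U"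
    and Gb: "G z1 \<le> b s" "G z2 \<le> b t"
    and fc: "ereal (f z1 s) \<le> c" "ereal (f z2 t) \<le> c"
    and hr: "ereal (h z1) \<le> r" "ereal (h z2) \<le> r"
  let ?z = "u *\<^sub>R z1 + v *\<^sub>R z2" and ?s = "u *\<^sub>R s + v *\<^sub>R t"
  show "?z \<in> X" using X z uv by (rule convexD)
  show "?s \<in> U" using U st uv by (rule convexD)
  show "G ?z \<le> b ?s"
    unfolding less_eq_vec_def
  proof
    fix i
    have "G ?z $ i \<le> u * G z1 $ i + v * G z2 $ i"
      using G[of i] uv unfolding convex_on_def by auto
    also have "\<dots> \<le> u * b s $ i + v * b t $ i"
      using Gb uv by (intro add_mono mult_left_mono) (auto simp: less_eq_vec_def)
    also have "\<dots> \<le> b ?s $ i"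
      using b[of i] uv unfolding concave_on_iff by auto
    finally show "G ?z $ i \<le> b ?s $ i" .
  qed
  \<comment> \<open>The maximum is one of the two endpoint values, and both lie below
    \<open>c\<close>; the same argument handles \<open>h\<close> and \<open>r\<close>.\<close>
  have "f ?z ?s \<le> max (f z1 s) (f z2 t)"
    using quasiconvex_onD[OF f, of "(z1, s)" "(z2, t)" u v] st uv by simp
  with fc show "ereal (f ?z ?s) \<le> c"
    by (metis ereal_less_eq(3) max_def order_trans)
  have "h ?z \<le> max (h z1) (h z2)"
    using quasiconvex_onD[OF h, of z1 z2 u v] uv by simp
  with hr show "ereal (h ?z) \<le> r"
    by (metis ereal_less_eq(3) max_def order_trans)
qed

theorem corollary1:
  fixes X :: "(real^'n) set"
    and U U' :: "(real^'k) set"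
    and F :: "real^'n \<Rightarrow> real^'k \<Rightarrow> real^'m"
    and f :: "real^'n \<Rightarrow> real^'k \<Rightarrow> real"
    and d :: "real^'n \<Rightarrow> real^'n \<Rightarrow> real"
    and G :: "real^'n \<Rightarrow> real^'m"
    and b :: "real^'k \<Rightarrow> real^'m"
    and xi :: "nat \<Rightarrow> real^'k"
    and N :: nat
  assumes "closed X"
    and "\<exists>\<xi>\<in>U. \<exists>\<eta>\<in>U. \<xi> \<noteq> \<eta>"
    and "\<And>\<xi>. \<xi> \<in> U \<Longrightarrow> continuous_on UNIV (\<lambda>x. F x \<xi>)"
    and "\<And>\<xi>. \<xi> \<in> U \<Longrightarrow> continuous_on UNIV (\<lambda>x. f x \<xi>)"
    and "Metric_space UNIV d"
    and "U' = xi ` {1..N}"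
    and "U = convex hull U'"
    and "\<And>x \<xi>. \<xi> \<in> U \<Longrightarrow> F x \<xi> = G x - b \<xi>"
    and "\<And>i. convex_on UNIV (\<lambda>x. G x $ i)"
    and "\<And>i. concave_on UNIV (\<lambda>\<xi>. b \<xi> $ i)"
    and "quasiconvex_on (UNIV \<times> U) (\<lambda>(x, \<xi>). f x \<xi>)"
    and "convex X"
    and "\<And>x. quasiconvex_on UNIV (\<lambda>z. d x z)"
  shows "recoverable_robust_solutions X F f d U = recoverable_robust_solutions X F f d U'"
proof (rule recoverable_robust_solutions_eqI)
  show sub: "U' \<subseteq> U" using assms(7) by (simp add: hull_subset)
  have convU: "convex U" using assms(7) by (simp add: convex_convex_hull)
  \<comment> \<open>Feasibility is put in the separated form that the region lemma uses.\<close>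
  have F_le: "F z \<xi> \<le> 0 \<longleftrightarrow> G z \<le> b \<xi>" if "\<xi> \<in> U" for z \<xi>
    using assms(8)[OF that] by (simp add: less_eq_vec_def)
  fix x y assume feas: "rec_feasible X F U' x y"
  \<comment> \<open>The bounds are the objective values of \<open>y\<close> itself, so any strategy
    selected from \<open>S\<close> does at least as well as \<open>y\<close>.\<close>
  define S where "S = {(z, \<xi>). z \<in> X \<and> \<xi> \<in> U \<and> G z \<le> b \<xi> \<and>
    ereal (f z \<xi>) \<le> rec_cost f U' y \<and> ereal (d x z) \<le> rec_distance d U' x y}"
  have "convex S"
    unfolding S_def by (intro convex_recovery_region assms convU)
  then have "convex (snd ` S)"
    by (intro convex_linear_image linear_snd)
  moreover have "U' \<subseteq> snd ` S"
  proof
    fix \<xi> assume \<xi>: "\<xi> \<in> U'"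
    \<comment> \<open>Each scenario's cost and distance under \<open>y\<close> lie below the
      respective supremum.\<close>
    have "(y \<xi>, \<xi>) \<in> S"
      using feas \<xi> sub F_le unfolding S_def rec_feasible_def rec_cost_def rec_distance_def
      by (auto intro: SUP_upper)
    then show "\<xi> \<in> snd ` S" by force
  qed
  ultimately have "U \<subseteq> snd ` S"
    using assms(7) by (simp add: hull_minimal)
  then have "\<forall>\<xi>\<in>U. \<exists>z. (z, \<xi>) \<in> S" by force
  \<comment> \<open>A recovery is chosen separately in each scenario; \<open>restrict\<close> below
    makes the choice extensional.\<close>
  then obtain g where g: "\<And>\<xi>. \<xi> \<in> U \<Longrightarrow> (g \<xi>, \<xi>) \<in> S" by metis
  show "\<exists>y'. rec_feasible X F U x y' \<and> rec_cost f U y' \<le> rec_cost f U' y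
      \<and> rec_distance d U x y' \<le> rec_distance d U' x y"
  proof (intro exI conjI)
    show "rec_feasible X F U x (restrict g U)"
      using g feas F_le unfolding rec_feasible_def S_def by auto
    show "rec_cost f U (restrict g U) \<le> rec_cost f U' y"
      \<comment> \<open>Only the supremum over \<open>U\<close> is unfolded; the one over
        \<open>U'\<close> stays folded, as it is the bound recorded in \<open>S\<close>.\<close>
      unfolding rec_cost_def[of f U] using g unfolding S_def by (auto intro: SUP_least)
    show "rec_distance d U x (restrict g U) \<le> rec_distance d U' x y"
      unfolding rec_distance_def[of d U] using g unfolding S_def by (auto intro: SUP_least)
  qed
qed

end
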